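(* Let $M,n\in\mathbb{N}$. The informational cost of the evaluation of a single random sample $X^{RE,i}_{M,n}$ of the truncated dimension randomized Euler algorithm, defined as $$\operatorname{cost}(X^{RE,i}_{M,n}):=\#\{\text{scalar evaluations of } a,b,c,\eta,W,N\},$$ equals $$d\,(n+Mn+N(T)+1)+Mn+n,$$ where $N(T)$ is the value at time $T$ of the Poisson process used for that sample. The expected informational cost of the algorithm, defined as $\operatorname{cost}(X^{RE}_{M,n}):=\mathbb{E}\big[\#\text{ of scalar evaluations of } a,b,c,\eta,W,N\big]$, equals $$d\,(n+Mn+\lambda T+1)+Mn+n .$$
   Context: **Setting.** $T>0$, $d,d'\in\mathbb{N}$, $\mathcal{E}=\mathbb{R}^{d'}\setminus\{0\}$; $W=[W_1,W_2,\dots]^T$ is a countably dimensional Wiener process; $N(\mathrm{d}y,\mathrm{d}t)$ is a Poisson random measure independent of $W$ with intensity measure $\nu(\mathrm{d}y)\,\mathrm{d}t$, where $\nu$ is a Lévy measure on $\mathcal{E}$ with $\lambda:=\nu(\mathcal{E})<\infty$. It is represented by a scalar Poisson process $(N(t))_{t\ge0}$ of intensity $\lambda$ and i.i.d. $\mathcal{E}$-valued jump heights $(\xi_k)_{k\ge1}$ with law $\nu(\mathrm{d}y)/\lambda$. The coefficients are $a:[0,T]\times\mathbb{R}^d\to\mathbb{R}^d$, $b=(b^{(1)},b^{(2)},\dots)$ with $b^{(k)}:[0,T]\times\mathbb{R}^d\to\mathbb{R}^d$, $c:[0,T]\times\mathbb{R}^d\times\mathbb{R}^{d'}\to\mathbb{R}^d$,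 and the initial value $\eta$ is an $\mathbb{R}^d$-valued random vector. **Algorithm.** With $t_j=jT/n$, $\Delta W_{j,k}=W_k(t_{j+1})-W_k(t_j)$, and independent $\theta_j$ uniform on $[t_j,t_{j+1}]$ (independent of $\eta,W,N$), set $X^{RE}_{M,n}(0)=\eta$ and, for $j=0,\dots,n-1$, $$X^{RE}_{M,n}(t_{j+1})=X^{RE}_{M,n}(t_j)+a(\theta_j,X^{RE}_{M,n}(t_j))\tfrac{T}{n}+\sum_{k=1}^{M}b^{(k)}(t_j,X^{RE}_{M,n}(t_j))\Delta W_{j,k}+\sum_{k=N(t_j)+1}^{N(t_{j+1})}c(t_j,X^{RE}_{M,n}(t_j),\xi_k).$$ $X^{RE}_{M,n}:=X^{RE}_{M,n}(T)$, and $X^{RE,i}_{M,n}$ is its $i$-th independent sample. **Counting convention.** Each evaluation of an $\mathbb{R}^d$-valued quantity ($\eta$, or $a$, or a component $b^{(k)}$, or $c$ at one point) counts as $d$ scalar evaluations. The initial value is evaluated once. In each of the $n$ steps, $a$ is evaluated once, each of $b^{(1)},\dots,b^{(M)}$ is evaluated once, $M$ scalar Wiener increments are evaluated (each counting as one), the Poisson process is evaluated once (counting as one), and $c$ is evaluated once for each jump of the Poisson process in $(t_j,t_{j+1}]$. *)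

theory Defs
  imports "HOL-Probability.Probability"
begin

context prob_space
begin

definition generated :: "('i \<Rightarrow> 'a \<Rightarrow> 'b::topological_space) \<Rightarrow> 'i set \<Rightarrow> 'a set set" where
  "generated X I = sigma_sets (space M) {X i -` A \<inter> space M | i A. i \<in> I \<and> A \<in> sets borel}"

definition independent_increments :: "(real \<Rightarrow> 'a \<Rightarrow> real) \<Rightarrow> bool" where
  "independent_increments X \<longleftrightarrow>
     (\<forall>(m::nat) t. 0 \<le> t 0 \<and> (\<forall>i<m. t i < t (Suc i)) \<longrightarrow>
        indep_vars (\<lambda>_. borel) (\<lambda>i \<omega>. X (t (Suc i)) \<omega> - X (t i) \<omega>) {..<m})"

definition wiener_process :: "(real \<Rightarrow> 'a \<Rightarrow> real) \<Rightarrow> bool" where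
  "wiener_process X \<longleftrightarrow>
     (\<forall>t\<ge>0. X t \<in> borel_measurable M) \<and>
     (AE \<omega> in M. X 0 \<omega> = 0) \<and>
     (AE \<omega> in M. continuous_on {0..} (\<lambda>t. X t \<omega>)) \<and>
     independent_increments X \<and>
     (\<forall>s t. 0 \<le> s \<and> s < t \<longrightarrow>
        distributed M lborel (\<lambda>\<omega>. X t \<omega> - X s \<omega>) (normal_density 0 (sqrt (t - s))))"

(* A counting process: the path properties hold for every outcome. The law of the increments
   is written out because poisson_pmf excludes rate 0. *)
definition poisson_process :: "real \<Rightarrow> (real \<Rightarrow> 'a \<Rightarrow> nat) \<Rightarrow> bool" where
  "poisson_process rate N \<longleftrightarrow>
     (\<forall>t\<ge>0. N t \<in> measurable M (count_space UNIV)) \<and>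
     (\<forall>\<omega>\<in>space M. N 0 \<omega> = 0) \<and>
     (\<forall>\<omega>\<in>space M. \<forall>s t. 0 \<le> s \<and> s \<le> t \<longrightarrow> N s \<omega> \<le> N t \<omega>) \<and>
     (\<forall>\<omega>\<in>space M. \<forall>t\<ge>0. continuous (at_right t) (\<lambda>s. real (N s \<omega>))) \<and>
     independent_increments (\<lambda>t \<omega>. real (N t \<omega>)) \<and>
     (\<forall>s t k. 0 \<le> s \<and> s < t \<longrightarrow>
        prob {\<omega> \<in> space M. N t \<omega> - N s \<omega> = k} =
          (rate * (t - s)) ^ k / fact k * exp (- (rate * (t - s))))"

end

abbreviation mark_space :: "'u::euclidean_space measure" where
  "mark_space \<equiv> restrict_space borel (UNIV - {0})"

definition levy_measure :: "'u::euclidean_space measure \<Rightarrow> bool" where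
  "levy_measure \<nu> \<longleftrightarrow> sets \<nu> = sets mark_space \<and>
     (\<integral>\<^sup>+ y. ennreal (min 1 ((norm y)\<^sup>2)) \<partial>\<nu>) < \<infinity>"

definition total_mass :: "'u measure \<Rightarrow> real" where
  "total_mass \<nu> = measure \<nu> (space \<nu>)"

definition grid :: "real \<Rightarrow> nat \<Rightarrow> nat \<Rightarrow> real" where
  "grid T n j = real j * T / real n"

(* The Poisson random measure enters through its representation by the Poisson process N and the
   jump heights \<xi> k. The indices of W and \<xi> start at 1. The law \<nu> / \<lambda> of the jump heights is only
   meaningful for \<lambda> > 0; if \<lambda> = 0 there are almost surely no jumps. *)
locale randomized_euler_setting = prob_space \<Omega>
  for \<Omega> :: "'w measure" +
  fixes T :: real
    and n :: nat
    and \<nu> :: "(real ^ 'e) measure"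
    and \<eta> :: "'w \<Rightarrow> real ^ 'd"
    and W :: "nat \<Rightarrow> real \<Rightarrow> 'w \<Rightarrow> real"
    and N :: "real \<Rightarrow> 'w \<Rightarrow> nat"
    and \<xi> :: "nat \<Rightarrow> 'w \<Rightarrow> real ^ 'e"
    and \<theta> :: "nat \<Rightarrow> 'w \<Rightarrow> real"
  assumes T_pos: "0 < T"
    and n_pos: "1 \<le> n"
    and levy: "levy_measure \<nu>"
    and finite_intensity: "emeasure \<nu> (space \<nu>) < \<infinity>"
    and eta_measurable: "\<eta> \<in> borel_measurable \<Omega>"
    and wiener: "\<And>k. 1 \<le> k \<Longrightarrow> wiener_process (W k)"
    and wiener_indep: "indep_sets (\<lambda>k. generated (W k) {0..}) {1..}"
    and poisson: "poisson_process (total_mass \<nu>) N"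
    and jumps_measurable: "\<And>k. 1 \<le> k \<Longrightarrow> \<xi> k \<in> measurable \<Omega> mark_space"
    and jumps_indep: "indep_vars (\<lambda>_. mark_space) \<xi> {1..}"
    and jumps_law: "\<And>k. 1 \<le> k \<Longrightarrow> 0 < total_mass \<nu> \<Longrightarrow>
          distr \<Omega> mark_space (\<xi> k) = scale_measure (ennreal (1 / total_mass \<nu>)) \<nu>"
    and poisson_jumps_indep:
      "indep_set (generated (\<lambda>t \<omega>. real (N t \<omega>)) {0..}) (generated \<xi> {1..})"
    and wiener_poisson_indep:
      "indep_set
         (sigma_sets (space \<Omega>) (\<Union>k\<in>{1..}. generated (W k) {0..}))
         (sigma_sets (space \<Omega>) (generated (\<lambda>t \<omega>. real (N t \<omega>)) {0..} \<union> generated \<xi> {1..}))"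
    and theta_uniform: "\<And>j. j < n \<Longrightarrow>
          distr \<Omega> borel (\<theta> j) = uniform_measure lborel {grid T n j..grid T n (Suc j)}"
    and theta_indep: "indep_vars (\<lambda>_. borel) \<theta> {..<n}"
    and theta_data_indep:
      "indep_set
         (generated \<theta> {..<n})
         (sigma_sets (space \<Omega>)
            (generated (\<lambda>_::unit. \<eta>) UNIV \<union> (\<Union>k\<in>{1..}. generated (W k) {0..}) \<union>
             generated (\<lambda>t \<omega>. real (N t \<omega>)) {0..} \<union> generated \<xi> {1..}))"


record ('v, 'u) data =
  init_val :: 'v
  drift :: "real \<Rightarrow> 'v \<Rightarrow> 'v"
  diffusion :: "nat \<Rightarrow> real \<Rightarrow> 'v \<Rightarrow> 'v"
  jump_coeff :: "real \<Rightarrow> 'v \<Rightarrow> 'u \<Rightarrow> 'v"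
  wiener_path :: "nat \<Rightarrow> real \<Rightarrow> real"
  poisson_path :: "real \<Rightarrow> nat"

(* A program is an interaction tree: it has no access to the data other than through the
   evaluations below, so that counting the evaluations along a run counts all of them.
   Eval_W k s t asks for the increment of the k-th Wiener process over [s, t]. *)
datatype ('v, 'u, 'x) program =
    Return 'x
  | Eval_eta "'v \<Rightarrow> ('v, 'u, 'x) program"
  | Eval_a real 'v "'v \<Rightarrow> ('v, 'u, 'x) program"
  | Eval_b nat real 'v "'v \<Rightarrow> ('v, 'u, 'x) program"
  | Eval_c real 'v 'u "'v \<Rightarrow> ('v, 'u, 'x) program"
  | Eval_W nat real real "real \<Rightarrow> ('v, 'u, 'x) program"
  | Eval_N real "nat \<Rightarrow> ('v, 'u, 'x) program"

primrec result :: "('v, 'u) data \<Rightarrow> ('v, 'u, 'x) program \<Rightarrow> 'x" where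
  "result D (Return x) = x"
| "result D (Eval_eta f) = result D (f (init_val D))"
| "result D (Eval_a t x f) = result D (f (drift D t x))"
| "result D (Eval_b k t x f) = result D (f (diffusion D k t x))"
| "result D (Eval_c t x y f) = result D (f (jump_coeff D t x y))"
| "result D (Eval_W k s t f) = result D (f (wiener_path D k t - wiener_path D k s))"
| "result D (Eval_N t f) = result D (f (poisson_path D t))"

(* The number of scalar evaluations in a run; an evaluation with values in 'v counts DIM('v). *)
primrec scalar_evaluations ::
  "('v::euclidean_space, 'u) data \<Rightarrow> ('v, 'u, 'x) program \<Rightarrow> nat" where
  "scalar_evaluations D (Return x) = 0"
| "scalar_evaluations D (Eval_eta f) = DIM('v) + scalar_evaluations D (f (init_val D))"
| "scalar_evaluations D (Eval_a t x f) = DIM('v) + scalar_evaluations D (f (drift D t x))"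
| "scalar_evaluations D (Eval_b k t x f) = DIM('v) + scalar_evaluations D (f (diffusion D k t x))"
| "scalar_evaluations D (Eval_c t x y f) = DIM('v) + scalar_evaluations D (f (jump_coeff D t x y))"
| "scalar_evaluations D (Eval_W k s t f) =
     1 + scalar_evaluations D (f (wiener_path D k t - wiener_path D k s))"
| "scalar_evaluations D (Eval_N t f) = 1 + scalar_evaluations D (f (poisson_path D t))"

primrec bind_program ::
  "('v, 'u, 'x) program \<Rightarrow> ('x \<Rightarrow> ('v, 'u, 'z) program) \<Rightarrow> ('v, 'u, 'z) program" where
  "bind_program (Return x) g = g x"
| "bind_program (Eval_eta f) g = Eval_eta (\<lambda>r. bind_program (f r) g)"
| "bind_program (Eval_a t x f) g = Eval_a t x (\<lambda>r. bind_program (f r) g)"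
| "bind_program (Eval_b k t x f) g = Eval_b k t x (\<lambda>r. bind_program (f r) g)"
| "bind_program (Eval_c t x y f) g = Eval_c t x y (\<lambda>r. bind_program (f r) g)"
| "bind_program (Eval_W k s t f) g = Eval_W k s t (\<lambda>r. bind_program (f r) g)"
| "bind_program (Eval_N t f) g = Eval_N t (\<lambda>r. bind_program (f r) g)"

primrec for_loop ::
  "('k \<Rightarrow> 'x \<Rightarrow> ('v, 'u, 'x) program) \<Rightarrow> 'k list \<Rightarrow> 'x \<Rightarrow> ('v, 'u, 'x) program" where
  "for_loop f [] s = Return s"
| "for_loop f (k # ks) s = bind_program (f k s) (for_loop f ks)"

lemma result_bind [simp]: "result D (bind_program p g) = result D (g (result D p))"
  by (induction p) auto


(* The state is X(t_j) together with the known value N(t_j), so that each step evaluates the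
   Poisson process only at the new point t_{j+1}. *)
definition euler_step ::
  "real \<Rightarrow> nat \<Rightarrow> nat \<Rightarrow> (nat \<Rightarrow> real) \<Rightarrow> (nat \<Rightarrow> 'u) \<Rightarrow> nat \<Rightarrow> 'v \<times> nat \<Rightarrow>
     ('v::euclidean_space, 'u, 'v \<times> nat) program" where
  "euler_step T M n \<theta> \<xi> j = (\<lambda>(x, p).
     Eval_a (\<theta> j) x (\<lambda>a_val.
     bind_program
       (for_loop
          (\<lambda>k s. Eval_b k (grid T n j) x (\<lambda>b_val.
                 Eval_W k (grid T n j) (grid T n (Suc j)) (\<lambda>dW.
                 Return (s + dW *\<^sub>R b_val))))
          [1..<Suc M] 0) (\<lambda>diffusion_part.
     Eval_N (grid T n (Suc j)) (\<lambda>q.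
     bind_program
       (for_loop
          (\<lambda>k s. Eval_c (grid T n j) x (\<xi> k) (\<lambda>c_val. Return (s + c_val)))
          [Suc p..<Suc q] 0) (\<lambda>jump_part.
     Return (x + (T / real n) *\<^sub>R a_val + diffusion_part + jump_part, q))))))"

definition euler_program ::
  "real \<Rightarrow> nat \<Rightarrow> nat \<Rightarrow> (nat \<Rightarrow> real) \<Rightarrow> (nat \<Rightarrow> 'u) \<Rightarrow>
     ('v::euclidean_space, 'u, 'v) program" where
  "euler_program T M n \<theta> \<xi> =
     Eval_eta (\<lambda>x. bind_program (for_loop (euler_step T M n \<theta> \<xi>) [0..<n] (x, 0))
                                (\<lambda>(y, p). Return y))"

(* The recursion that euler_program carries out, see result_euler_program. *)
primrec euler_scheme ::
  "real \<Rightarrow> nat \<Rightarrow> nat \<Rightarrow> (nat \<Rightarrow> real) \<Rightarrow> (nat \<Rightarrow> 'u) \<Rightarrow> ('v::euclidean_space, 'u) data \<Rightarrow>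
     nat \<Rightarrow> 'v" where
  "euler_scheme T M n \<theta> \<xi> D 0 = init_val D"
| "euler_scheme T M n \<theta> \<xi> D (Suc j) =
     euler_scheme T M n \<theta> \<xi> D j
     + (T / real n) *\<^sub>R drift D (\<theta> j) (euler_scheme T M n \<theta> \<xi> D j)
     + (\<Sum>k=1..M. (wiener_path D k (grid T n (Suc j)) - wiener_path D k (grid T n j)) *\<^sub>R
                    diffusion D k (grid T n j) (euler_scheme T M n \<theta> \<xi> D j))
     + (\<Sum>k=poisson_path D (grid T n j) + 1..poisson_path D (grid T n (Suc j)).
          jump_coeff D (grid T n j) (euler_scheme T M n \<theta> \<xi> D j) (\<xi> k))"

lemma for_loop_append:
  "result D (for_loop f (ks @ ls) s) = result D (for_loop f ls (result D (for_loop f ks s)))"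
  by (induction ks arbitrary: s) auto

lemma for_loop_diffusion:
  "result D (for_loop (\<lambda>k s. Eval_b k t x (\<lambda>b. Eval_W k t u (\<lambda>dW. Return (s + dW *\<^sub>R b)))) ks s) =
     s + (\<Sum>k\<leftarrow>ks. (wiener_path D k u - wiener_path D k t) *\<^sub>R diffusion D k t x)"
  by (induction ks arbitrary: s) (auto simp: algebra_simps)

lemma for_loop_jump:
  "result D (for_loop (\<lambda>k s. Eval_c t x (\<xi> k) (\<lambda>c. Return (s + c))) ks s) =
     (s::'v::euclidean_space) + (\<Sum>k\<leftarrow>ks. jump_coeff D t x (\<xi> k))"
  by (induction ks arbitrary: s) (auto simp: algebra_simps)

lemma result_euler_program:
  assumes "poisson_path D 0 = 0"
  shows "result D (euler_program T M n \<theta> \<xi>) = euler_scheme T M n \<theta> \<xi> D n"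
proof -
  have "result D (for_loop (euler_step T M n \<theta> \<xi>) [0..<j] (init_val D, 0)) =
          (euler_scheme T M n \<theta> \<xi> D j, poisson_path D (grid T n j))" for j
  proof (induction j)
    case 0
    then show ?case using assms by (simp add: grid_def)
  next
    case (Suc j)
    have *: "sum_list (map f [i..<Suc l]) = sum f {i..l}" for f :: "nat \<Rightarrow> 'a" and i l
      by (metis atLeastLessThanSuc_atLeastAtMost interv_sum_list_conv_sum_set_nat set_upt)
    show ?case
      unfolding upt_Suc_append[OF le0] for_loop_append Suc.IH
      by (simp add: euler_step_def for_loop_diffusion for_loop_jump * del: upt_Suc)
  qed
  then show ?thesis
    by (simp add: euler_program_def)
qed

definition sample_data ::
  "(real \<Rightarrow> 'v \<Rightarrow> 'v) \<Rightarrow> (nat \<Rightarrow> real \<Rightarrow> 'v \<Rightarrow> 'v) \<Rightarrow> (real \<Rightarrow> 'v \<Rightarrow> 'u \<Rightarrow> 'v) \<Rightarrow>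
   ('w \<Rightarrow> 'v) \<Rightarrow> (nat \<Rightarrow> real \<Rightarrow> 'w \<Rightarrow> real) \<Rightarrow> (real \<Rightarrow> 'w \<Rightarrow> nat) \<Rightarrow> 'w \<Rightarrow> ('v, 'u) data" where
  "sample_data a b c \<eta> W N \<omega> =
     \<lparr>init_val = \<eta> \<omega>, drift = a, diffusion = b, jump_coeff = c,
      wiener_path = (\<lambda>k t. W k t \<omega>), poisson_path = (\<lambda>t. N t \<omega>)\<rparr>"

definition euler_cost ::
  "real \<Rightarrow> nat \<Rightarrow> nat \<Rightarrow>
   (real \<Rightarrow> 'v::euclidean_space \<Rightarrow> 'v) \<Rightarrow> (nat \<Rightarrow> real \<Rightarrow> 'v \<Rightarrow> 'v) \<Rightarrow> (real \<Rightarrow> 'v \<Rightarrow> 'u \<Rightarrow> 'v) \<Rightarrow>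
   ('w \<Rightarrow> 'v) \<Rightarrow> (nat \<Rightarrow> real \<Rightarrow> 'w \<Rightarrow> real) \<Rightarrow> (real \<Rightarrow> 'w \<Rightarrow> nat) \<Rightarrow>
   (nat \<Rightarrow> 'w \<Rightarrow> 'u) \<Rightarrow> (nat \<Rightarrow> 'w \<Rightarrow> real) \<Rightarrow> 'w \<Rightarrow> nat" where
  "euler_cost T M n a b c \<eta> W N \<xi> \<theta> \<omega> =
     scalar_evaluations (sample_data a b c \<eta> W N \<omega>)
       (euler_program T M n (\<lambda>j. \<theta> j \<omega>) (\<lambda>k. \<xi> k \<omega>))"

end

theory Submission
  imports Defs
begin

text \<open>
  A run of the scheme consists of one evaluation of the initial value and \<open>n\<close> steps.
  In the \<open>j\<close>-th step only the number of evaluations of the jump coefficient depends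
  on the data: it is the increment of the Poisson path over the step. Each of these evaluations
  has the same price \<open>d\<close>, the dimension of the state space, whatever the state and
  the jump heights are, so the increments telescope over the grid, from \<open>N 0 = 0\<close> to
  \<open>N T\<close>; hence the pathwise formula
  (\<open>scalar_evaluations_euler_program\<close>). Two properties of the path enter: it starts
  at zero, which is the value with which the program initialises its memory of the Poisson
  process, and it is nondecreasing, without which the difference of natural numbers that counts
  the jumps of a step would be truncated.

  The pathwise cost is thus an affine function of \<open>N T\<close>, and its expectation follows
  from the mean \<open>\<lambda> T\<close> of the Poisson law
  (\<open>poisson_process_mean\<close>), where \<open>\<lambda>\<close> is the total mass of
  \<open>\<nu>\<close>. That mean is computed from the probabilities of the single values, which
  covers \<open>\<lambda> = 0\<close> as well.
\<close>

lemma scalar_evaluations_bind [simp]: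
  "scalar_evaluations D (bind_program p g) =
     scalar_evaluations D p + scalar_evaluations D (g (result D p))"
  by (induction p) auto

lemma scalar_evaluations_for_loop_append:
  "scalar_evaluations D (for_loop f (ks @ ls) s) =
     scalar_evaluations D (for_loop f ks s) +
     scalar_evaluations D (for_loop f ls (result D (for_loop f ks s)))"
  by (induction ks arbitrary: s) auto

lemma scalar_evaluations_for_loop_const:
  assumes "\<And>k s. scalar_evaluations D (f k s) = m"
  shows "scalar_evaluations D (for_loop f ks s) = length ks * m"
  by (induction ks arbitrary: s) (simp_all add: assms)

text \<open>
  The second component of the state carries the last value of the Poisson process that was
  evaluated; the next step takes its first jump index from it.
\<close>

lemma snd_result_euler_step:
  "snd (result D (euler_step T M n \<theta> \<xi> j s)) = poisson_path D (grid T n (Suc j))"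
  by (simp add: euler_step_def split_beta)

text \<open>
  The two inner loops have bodies of constant price: \<open>d + 1\<close> for a diffusion coefficient with
  its Wiener increment, and \<open>d\<close> for a jump. The drift adds another \<open>d\<close>, and the Poisson
  process the final \<open>1\<close>.
\<close>

lemma scalar_evaluations_euler_step:
  fixes s :: "'v::euclidean_space \<times> nat"
  shows "scalar_evaluations D (euler_step T M n \<theta> \<xi> j s) =
     DIM('v) * (1 + M + (poisson_path D (grid T n (Suc j)) - snd s)) + M + 1"
  by (simp add: euler_step_def split_beta scalar_evaluations_for_loop_const algebra_simps
      del: upt_Suc)

text \<open>
  Induction over the steps: the jumps counted up to step \<open>j\<close> add up to the value of the Poisson
  path at the \<open>j\<close>-th grid point.
\<close>

lemma scalar_evaluations_euler_program:
  fixes D :: "('v::euclidean_space, 'u) data"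
  assumes start: "poisson_path D 0 = 0"
    and step: "\<And>j. j < n \<Longrightarrow> poisson_path D (grid T n j) \<le> poisson_path D (grid T n (Suc j))"
  shows "scalar_evaluations D (euler_program T M n \<theta> \<xi>) =
     DIM('v) * (n + M * n + poisson_path D (grid T n n) + 1) + M * n + n"
proof -
  let ?loop = "\<lambda>j. for_loop (euler_step T M n \<theta> \<xi>) [0..<j] (init_val D, 0)"
  have known: "snd (result D (?loop j)) = poisson_path D (grid T n j)" for j
    using start
    by (cases j) (simp_all add: grid_def for_loop_append snd_result_euler_step)
  have "scalar_evaluations D (?loop j) =
          DIM('v) * (j + M * j + poisson_path D (grid T n j)) + M * j + j" if "j \<le> n" for j
    using that
  proof (induction j)
    case 0
    then show ?case using start by (simp add: grid_def)
  next
    case (Suc j)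
    \<comment> \<open>Writing the new value as a sum turns the truncated difference into the honest number of
      jumps, so that the terms telescope by ring arithmetic.\<close>
    obtain r where "poisson_path D (grid T n (Suc j)) = poisson_path D (grid T n j) + r"
      using step[of j] Suc.prems by (auto simp: le_iff_add)
    then show ?case
      using Suc
      by (simp add: scalar_evaluations_for_loop_append scalar_evaluations_euler_step known
          algebra_simps)
  qed
  then show ?thesis
    by (simp add: euler_program_def split_beta algebra_simps)
qed

text \<open>
  The factor \<open>k\<close> cancels against the factorial, so that the series is \<open>\<mu> exp (- \<mu>)\<close> times the
  exponential series, shifted by one index.
\<close>

lemma poisson_mean_sums:
  "(\<lambda>k. real k * (\<mu> ^ k / fact k * exp (- \<mu>))) sums \<mu>" for \<mu> :: real
proof -
  have "(\<lambda>k. \<mu> ^ k / fact k) sums exp \<mu>"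
    using exp_converges[of \<mu>] by (simp add: field_simps)
  then have "(\<lambda>k. \<mu> * exp (- \<mu>) * (\<mu> ^ k / fact k)) sums (\<mu> * exp (- \<mu>) * exp \<mu>)"
    by (rule sums_mult)
  moreover have "\<mu> * exp (- \<mu>) * exp \<mu> = \<mu>"
    by (simp add: exp_minus)
  moreover have "real (Suc k) * (\<mu> ^ Suc k / fact (Suc k) * exp (- \<mu>)) =
      \<mu> * exp (- \<mu>) * (\<mu> ^ k / fact k)" for k
    by (simp add: field_simps del: of_nat_Suc)
  ultimately have "(\<lambda>k. real (Suc k) * (\<mu> ^ Suc k / fact (Suc k) * exp (- \<mu>))) sums \<mu>"
    by (simp only:)
  then show ?thesis
    by (subst (asm) sums_Suc_iff) simp
qed

text \<open>
  The law of \<open>X\<close> has the point probabilities as its density with respect to the counting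
  measure, and integrals over the counting measure on the naturals are series. The terms of the
  series are nonnegative, so that its convergence is absolute and gives integrability.
\<close>

lemma (in prob_space) expectation_nat_sums:
  fixes X :: "'a \<Rightarrow> nat"
  assumes X [measurable]: "X \<in> measurable M (count_space UNIV)"
    and sums: "(\<lambda>k. real k * prob {\<omega> \<in> space M. X \<omega> = k}) sums m"
  shows "has_bochner_integral M (\<lambda>\<omega>. real (X \<omega>)) m"
proof -
  define p where "p k = prob {\<omega> \<in> space M. X \<omega> = k}" for k
  have p: "p k \<ge> 0" for k by (simp add: p_def)
  have law: "distr M (count_space UNIV) X = density (count_space UNIV) (\<lambda>k. ennreal (p k))"
  proof (rule measure_eqI_countable[where A = UNIV])
    fix k :: nat
    have "emeasure (distr M (count_space UNIV) X) {k} = ennreal (p k)"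
      by (simp add: emeasure_distr p_def emeasure_eq_measure vimage_def Int_def conj_commute)
    then show "emeasure (distr M (count_space UNIV) X) {k} =
        emeasure (density (count_space UNIV) (\<lambda>k. ennreal (p k))) {k}"
      by (simp add: emeasure_density nn_integral_count_space_indicator[symmetric])
  qed auto
  have "integrable (count_space UNIV) (\<lambda>k. p k * real k)"
    using sums p by (simp add: integrable_count_space_nat_iff p_def mult.commute sums_summable)
  moreover from sums_integral_count_space_nat[OF this]
  have "integral\<^sup>L (count_space UNIV) (\<lambda>k. p k * real k) = m"
    by (rule sums_unique2) (use sums in \<open>simp add: p_def mult.commute\<close>)
  ultimately have "has_bochner_integral (distr M (count_space UNIV) X) real m"
    unfolding law using p by (simp add: has_bochner_integral_iff integrable_density integral_density)
  then show ?thesis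
    by (simp add: has_bochner_integral_iff integrable_distr_eq integral_distr)
qed

lemma (in prob_space) poisson_process_mean:
  assumes "poisson_process rate N" and "0 < t"
  shows "has_bochner_integral M (\<lambda>\<omega>. real (N t \<omega>)) (rate * t)"
proof (rule expectation_nat_sums)
  show "N t \<in> measurable M (count_space UNIV)"
    using assms by (simp add: poisson_process_def)
  \<comment> \<open>The law is given for increments; since the process starts at zero, its value is the
    increment over the interval from \<open>0\<close> to \<open>t\<close>.\<close>
  have "prob {\<omega> \<in> space M. N t \<omega> = k} = (rate * t) ^ k / fact k * exp (- (rate * t))" for k
  proof -
    have "{\<omega> \<in> space M. N t \<omega> = k} = {\<omega> \<in> space M. N t \<omega> - N 0 \<omega> = k}"
      using assms(1) by (auto simp: poisson_process_def)
    also have "prob \<dots> = (rate * (t - 0)) ^ k / fact k * exp (- (rate * (t - 0)))"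
      using assms by (simp add: poisson_process_def)
    finally show ?thesis by simp
  qed
  then show "(\<lambda>k. real k * prob {\<omega> \<in> space M. N t \<omega> = k}) sums (rate * t)"
    using poisson_mean_sums[of "rate * t"] by simp
qed

theorem proposition1:
  fixes \<Omega> :: "'w measure"
    and T :: real
    and M n :: nat
    and \<nu> :: "(real ^ 'e) measure"
    and \<eta> :: "'w \<Rightarrow> real ^ 'd"
    and W :: "nat \<Rightarrow> real \<Rightarrow> 'w \<Rightarrow> real"
    and N :: "real \<Rightarrow> 'w \<Rightarrow> nat"
    and \<xi> :: "nat \<Rightarrow> 'w \<Rightarrow> real ^ 'e"
    and \<theta> :: "nat \<Rightarrow> 'w \<Rightarrow> real"
    and a :: "real \<Rightarrow> real ^ 'd \<Rightarrow> real ^ 'd"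
    and b :: "nat \<Rightarrow> real \<Rightarrow> real ^ 'd \<Rightarrow> real ^ 'd"
    and c :: "real \<Rightarrow> real ^ 'd \<Rightarrow> real ^ 'e \<Rightarrow> real ^ 'd"
  defines "d \<equiv> CARD('d)"
    and "lam \<equiv> total_mass \<nu>"
  assumes "randomized_euler_setting \<Omega> T n \<nu> \<eta> W N \<xi> \<theta>"
  shows "(\<forall>\<omega>\<in>space \<Omega>. euler_cost T M n a b c \<eta> W N \<xi> \<theta> \<omega> =
             d * (n + M * n + N T \<omega> + 1) + M * n + n) \<and>
         prob_space.expectation \<Omega> (\<lambda>\<omega>. real (euler_cost T M n a b c \<eta> W N \<xi> \<theta> \<omega>)) =
             real d * (real n + real M * real n + lam * T + 1) + real M * real n + real n"
proof -
  interpret randomized_euler_setting \<Omega> T n \<nu> \<eta> W N \<xi> \<theta>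
    by (rule assms(3))
  have cost: "euler_cost T M n a b c \<eta> W N \<xi> \<theta> \<omega> =
      d * (n + M * n + N T \<omega> + 1) + M * n + n" if \<omega>: "\<omega> \<in> space \<Omega>" for \<omega>
  proof -
    have "N 0 \<omega> = 0"
      using poisson \<omega> by (simp add: poisson_process_def)
    moreover have "N (grid T n j) \<omega> \<le> N (grid T n (Suc j)) \<omega>" for j
    proof -
      have "0 \<le> grid T n j" "grid T n j \<le> grid T n (Suc j)"
        using T_pos by (simp_all add: grid_def divide_right_mono)
      then show ?thesis
        using poisson \<omega> unfolding poisson_process_def by blast
    qed
    moreover have "grid T n n = T"
      using n_pos by (simp add: grid_def)
    ultimately show ?thesis
      unfolding euler_cost_def d_def
      by (subst scalar_evaluations_euler_program) (simp_all add: sample_data_def)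
  qed
  have mean: "integrable \<Omega> (\<lambda>\<omega>. real (N T \<omega>))" "expectation (\<lambda>\<omega>. real (N T \<omega>)) = lam * T"
    using poisson_process_mean[OF poisson T_pos]
    by (simp_all add: has_bochner_integral_iff lam_def)
  have "expectation (\<lambda>\<omega>. real (euler_cost T M n a b c \<eta> W N \<xi> \<theta> \<omega>)) =
      expectation (\<lambda>\<omega>. real d * real (N T \<omega>) + real (d * (n + M * n + 1) + M * n + n))"
    by (intro Bochner_Integration.integral_cong) (simp_all add: cost algebra_simps)
  also have "\<dots> = real d * (lam * T) + real (d * (n + M * n + 1) + M * n + n)"
    using mean by (simp add: prob_space)
  finally show ?thesis
    using cost by (simp add: algebra_simps)
qed

end
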